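(* Let $g:\mathbb{R}\to\mathbb{C}$ be a $1$-periodic, real analytic function with $\int_0^1 g(x)\,dx=0$, and let $\alpha$ be a Diophantine real number. Then the series $$ \zeta_{g,\alpha}(s)=\sum_{n=1}^{\infty}\frac{g(n\alpha)}{n^s} $$ converges and is analytic for $\mathrm{Re}(s)>0$. In other words, the abscissa of convergence of this Dirichlet series is $0$.
   Context: A real number $\alpha$ is Diophantine of type $r$ (where $r>1$) if there exists $C>0$ such that $|\alpha-\frac{p}{q}|\ge \frac{C}{q^{1+r}}$ for all rational numbers $p/q$ (with $q\geq 1$); $\alpha$ is Diophantine if it is Diophantine of type $r$ for some $r>1$. The abscissa of convergence of a Dirichlet series $\sum_{n\ge1} a_n n^{-s}$ is the number $\sigma_0\in[-\infty,\infty]$ such that the series converges for $\mathrm{Re}(s)>\sigma_0$ and diverges for $\mathrm{Re}(s)<\sigma_0$.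
   Formalization: The claim that the abscissa of convergence is 0 is stated only for g not identically zero, since for g = 0 the series converges everywhere and its abscissa is −∞; convergence and analyticity for Re(s) > 0 are stated for every g. *)

theory Defs
  imports "HOL-Analysis.Analysis"
begin

definition diophantine_of_type :: "real \<Rightarrow> real \<Rightarrow> bool" where
  "diophantine_of_type r \<alpha> \<longleftrightarrow>
     (\<exists>C>0. \<forall>(p::int) (q::nat). q \<ge> 1 \<longrightarrow>
        \<bar>\<alpha> - real_of_int p / real q\<bar> \<ge> C / real q powr (1 + r))"

definition diophantine :: "real \<Rightarrow> bool" where
  "diophantine \<alpha> \<longleftrightarrow> (\<exists>r>1. diophantine_of_type r \<alpha>)"

(* The library predicate analytic_on is only about functions complex => complex. *)
definition real_analytic :: "(real \<Rightarrow> complex) \<Rightarrow> bool" where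
  "real_analytic g \<longleftrightarrow>
     (\<forall>x0. \<exists>\<rho>>0. \<exists>c::nat \<Rightarrow> complex. \<forall>x. \<bar>x - x0\<bar> < \<rho> \<longrightarrow>
        (\<lambda>k. c k * of_real (x - x0) ^ k) sums g x)"

(* Index shift: the k-th term is a n / n^s with n = k + 1, so a 0 is never used. *)
definition dirichlet_term :: "(nat \<Rightarrow> complex) \<Rightarrow> complex \<Rightarrow> nat \<Rightarrow> complex" where
  "dirichlet_term a s k = a (Suc k) / of_nat (Suc k) powr s"

definition dirichlet_series :: "(nat \<Rightarrow> complex) \<Rightarrow> complex \<Rightarrow> complex" where
  "dirichlet_series a s = (\<Sum>k. dirichlet_term a s k)"

definition has_abscissa_of_convergence :: "(nat \<Rightarrow> complex) \<Rightarrow> ereal \<Rightarrow> bool" where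
  "has_abscissa_of_convergence a \<sigma>0 \<longleftrightarrow>
     (\<forall>s. ereal (Re s) > \<sigma>0 \<longrightarrow> summable (dirichlet_term a s)) \<and>
     (\<forall>s. ereal (Re s) < \<sigma>0 \<longrightarrow> \<not> summable (dirichlet_term a s))"

lemma has_abscissa_of_convergence_unique:
  assumes "has_abscissa_of_convergence a \<sigma>" and "has_abscissa_of_convergence a \<tau>"
  shows "\<sigma> = \<tau>"
proof -
  have False
    if "has_abscissa_of_convergence a u" "has_abscissa_of_convergence a v" "u < v" for u v
  proof -
    obtain x :: real where "u < ereal x" "ereal x < v"
      using \<open>u < v\<close> ereal_dense2 by blast
    then show False
      using that(1,2) unfolding has_abscissa_of_convergence_def
      by (metis Re_complex_of_real)
  qed
  then show ?thesis
    using assms by (metis neqE)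
qed

definition zeta_coeff :: "(real \<Rightarrow> complex) \<Rightarrow> real \<Rightarrow> nat \<Rightarrow> complex" where
  "zeta_coeff g \<alpha> n = g (real n * \<alpha>)"

definition zeta :: "(real \<Rightarrow> complex) \<Rightarrow> real \<Rightarrow> complex \<Rightarrow> complex" where
  "zeta g \<alpha> = dirichlet_series (zeta_coeff g \<alpha>)"

end

(* A real analytic 1-periodic g has Fourier coefficients decaying faster than any power, and for
   Diophantine alpha the geometric sums of e(k n alpha) over n grow at most polynomially in k. Summing the
   Fourier series along the orbit therefore shows that the sums g(alpha) + ... + g(N alpha) are
   bounded, and Abel summation gives locally uniform convergence for Re s > 0. For Re s < 0 the
   terms do not tend to 0, since the orbit of an irrational rotation returns arbitrarily late to
   any place where g is bounded away from 0. *)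

theory Submission
  imports Defs "HOL-Complex_Analysis.Complex_Analysis"
begin

subsection \<open>The characters of the circle\<close>

text \<open>The small divisor \<open>echar (k * \<alpha>) - 1\<close> costs only a fixed power: it
  is at least a constant times |k|^(-r), so Fourier decay of order r + 2 leaves a bound of order
  |k|^(-2), summable and uniform in the number N of orbit points. Any prescribed order of decay is
  reached by repeated integration by parts, with no complex strip, because the derivative of a
  periodic real analytic function is again periodic and real analytic. Frequency 0 has a vanishing
  divisor and would contribute N times the mean; the zero integral removes exactly this term.
  Estimates on coefficients say nothing about the orbit sums until the Fourier series is known to
  converge to \<open>g\<close> at every point, and this is where an elementary telescoping argument
  enters.\<close>

definition echar :: "real \<Rightarrow> complex" where
  "echar x = cis (2 * pi * x)"

lemma echar_0 [simp]: "echar 0 = 1"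
  by (simp add: echar_def)

lemma norm_echar [simp]: "norm (echar x) = 1"
  by (simp add: echar_def)

lemma echar_add: "echar (x + y) = echar x * echar y"
  by (simp add: echar_def cis_mult ring_distribs)

lemma echar_diff: "echar (x - y) = echar x / echar y"
  by (simp add: echar_def cis_divide ring_distribs)

lemma echar_of_int [simp]: "echar (of_int n) = 1"
  using cis_multiple_2pi[of "of_int n"] by (simp add: echar_def)

lemma echar_of_nat_mult: "echar (of_nat n * x) = echar x ^ n"
  unfolding echar_def by (subst Complex.DeMoivre) (simp only: mult_ac)

lemma has_vector_derivative_echar_mult:
  "((\<lambda>x. echar (c * x)) has_vector_derivative 2 * pi * c * \<i> * echar (c * x)) (at x within S)"
proof -
  have "((\<lambda>z. exp (2 * pi * c * \<i> * z)) has_field_derivative 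
          2 * pi * c * \<i> * exp (2 * pi * c * \<i> * of_real x)) (at (of_real x))"
    by (auto intro!: derivative_eq_intros)
  from has_vector_derivative_real_field[OF this] show ?thesis
    by (simp add: echar_def cis_conv_exp mult_ac)
qed

lemma continuous_on_echar [continuous_intros]:
  "continuous_on S f \<Longrightarrow> continuous_on S (\<lambda>x. echar (f x))"
  unfolding echar_def by (intro continuous_intros)

text \<open>A crude form of Jordan's inequality. Up to pi/3 the difference sin t - t/2 has
  derivative cos t - 1/2 >= 0; beyond, sin t >= sqrt 3 / 2 >= 17/20 >= pi/4 >= t/2.\<close>

lemma sin_ge_half:
  fixes t :: real
  assumes "0 \<le> t" "t \<le> pi / 2"
  shows "t / 2 \<le> sin t"
proof (cases "t \<le> pi / 3")
  case True
  have "sin 0 - 0 / 2 \<le> sin t - t / 2"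
  proof (rule DERIV_nonneg_imp_nondecreasing[where f = "\<lambda>t. sin t - t / 2"])
    fix x assume "0 \<le> x" "x \<le> t"
    hence "cos (pi/3) \<le> cos x"
      using True by (intro cos_monotone_0_pi_le) auto
    thus "\<exists>y. ((\<lambda>t. sin t - t / 2) has_real_derivative y) (at x) \<and> 0 \<le> y"
      by (intro exI[of _ "cos x - 1/2"] conjI) (auto intro!: derivative_eq_intros simp: cos_60)
  qed (use assms in auto)
  thus ?thesis by simp
next
  case False
  have "sin (pi/3) \<le> sin t"
    using False assms by (intro sin_monotone_2pi_le) auto
  moreover have "17/10 \<le> sqrt 3"
    by (rule real_le_rsqrt) (simp add: power2_eq_square)
  moreover have "pi / 4 \<le> 17 / 20"
    using pi_approx by simp
  ultimately show ?thesis using assms by (simp add: sin_60)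
qed

text \<open>The chord has length 2 |sin(pi y)| with y the signed distance of x to the nearest
  integer, and |y| <= 1/2 keeps pi |y| within reach of \<open>sin_ge_half\<close>. This turns
  approximation by integers into a lower bound for the small divisors; the constant 2 is not
  sharp.\<close>

lemma norm_echar_minus_one_ge: "2 * \<bar>x - of_int (round x)\<bar> \<le> norm (echar x - 1)"
proof -
  define y where "y = x - of_int (round x)"
  have y: "\<bar>y\<bar> \<le> 1 / 2"
    using of_int_round_abs_le[of x] by (simp add: y_def abs_minus_commute)
  have "echar x = echar y"
    unfolding y_def by (simp add: echar_diff)
  hence "norm (echar x - 1) = norm (exp (\<i> * of_real (2 * pi * y)) - 1)"
    by (simp add: echar_def cis_conv_exp)
  also have "\<dots> = 2 * \<bar>sin (pi * y)\<bar>"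
    by (subst dist_exp_i_1) simp
  also have "\<bar>sin (pi * y)\<bar> = \<bar>sin (pi * \<bar>y\<bar>)\<bar>"
    by (cases "y \<ge> 0") auto
  finally have "norm (echar x - 1) = 2 * \<bar>sin (pi * \<bar>y\<bar>)\<bar>" .
  moreover have "pi * \<bar>y\<bar> / 2 \<le> sin (pi * \<bar>y\<bar>)"
    using y by (intro sin_ge_half) auto
  moreover have "2 * \<bar>y\<bar> \<le> pi * \<bar>y\<bar>"
    using pi_ge_two by (intro mult_right_mono) auto
  ultimately show ?thesis unfolding y_def[symmetric] by linarith
qed

lemma echar_eq_1_iff: "echar x = 1 \<longleftrightarrow> x \<in> \<int>"
proof
  assume "echar x = 1"
  hence "2 * \<bar>x - of_int (round x)\<bar> \<le> 0"
    using norm_echar_minus_one_ge[of x] by simp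
  hence "x = of_int (round x)" by simp
  thus "x \<in> \<int>" by (metis Ints_of_int)
qed (auto elim: Ints_cases)

subsection \<open>Derivatives of real analytic functions\<close>

text \<open>Power series may be differentiated termwise inside their disc, and the differentiated
  series is a local expansion of the derivative. Being real analytic is thus inherited, which lets
  the decay argument be iterated.\<close>

lemma real_analytic_deriv:
  assumes "real_analytic g"
  obtains g' where "real_analytic g'" "\<And>x. (g has_vector_derivative g' x) (at x)"
proof
  \<comment> \<open>A single global choice, made before any expansion, so that the derivatives
    computed around different centres agree.\<close>
  define g' where "g' = (\<lambda>x. vector_derivative g (at x))"
  have *: "(g has_vector_derivative (\<Sum>k. diffs c k * of_real (x - x0) ^ k)) (at x) \<and>
           summable (\<lambda>k. diffs c k * of_real (x - x0) ^ k)"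
    if c: "\<forall>x. \<bar>x - x0\<bar> < \<rho> \<longrightarrow> (\<lambda>k. c k * of_real (x - x0) ^ k) sums g x"
      and x: "\<bar>x - x0\<bar> < \<rho>" for c x0 \<rho> x
  proof -
    \<comment> \<open>Termwise differentiation needs convergence at a point of strictly larger
      modulus; the midpoint between |x - x0| and the radius provides a real one, where the
      hypothesis applies.\<close>
    define K :: real where "K = (\<bar>x - x0\<bar> + \<rho>) / 2"
    have K: "\<bar>x - x0\<bar> < K" "K < \<rho>" "K > 0"
      using x by (auto simp: K_def)
    have "(\<lambda>k. c k * of_real (x0 + K - x0) ^ k) sums g (x0 + K)"
      using K by (intro c[rule_format]) auto
    hence sm: "summable (\<lambda>k. c k * of_real K ^ k)"
      by (simp add: sums_iff)
    have nrm: "norm (of_real (x - x0) :: complex) < norm (of_real K :: complex)"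
      using K by (metis abs_of_pos norm_of_real)
    have 1: "((\<lambda>z. \<Sum>k. c k * z ^ k) has_field_derivative (\<Sum>k. diffs c k * of_real (x - x0) ^ k)) 
          (at (of_real (x - x0)))"
      by (rule termdiffs_strong[OF sm nrm])
    have "((\<lambda>y. complex_of_real (y - x0)) has_vector_derivative 1) (at x)"
      by (auto intro!: derivative_eq_intros)
    from field_vector_diff_chain_at[OF this 1]
    have "((\<lambda>y. \<Sum>k. c k * of_real (y - x0) ^ k) has_vector_derivative (\<Sum>k. diffs c k * of_real (x - x0) ^ k)) (at x)"
      by (simp add: o_def)
    moreover have "\<forall>\<^sub>F y in nhds x. g y = (\<Sum>k. c k * of_real (y - x0) ^ k)"
    proof -
      have "open {y. \<bar>y - x0\<bar> < \<rho>}"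
        by (intro open_Collect_less continuous_intros)
      from eventually_nhds_in_open[OF this, of x] x show ?thesis
        by (auto elim!: eventually_mono dest: c[rule_format] simp: sums_iff)
    qed
    ultimately have "(g has_vector_derivative (\<Sum>k. diffs c k * of_real (x - x0) ^ k)) (at x)"
      by (subst has_vector_derivative_cong_ev[where g = "\<lambda>y. \<Sum>k. c k * of_real (y - x0) ^ k"])
         (auto dest: eventually_nhds_x_imp_x elim: eventually_mono)
    moreover have "summable (\<lambda>k. diffs c k * of_real (x - x0) ^ k)"
      by (rule termdiff_converges[of _ K]) (use nrm K sm in \<open>auto intro: powser_inside\<close>)
    ultimately show ?thesis by blast
  qed
  show "real_analytic g'"
    unfolding real_analytic_def
  proof
    fix x0
    obtain \<rho> c where \<rho>: "\<rho> > 0" and c: "\<forall>x. \<bar>x - x0\<bar> < \<rho> \<longrightarrow> (\<lambda>k. c k * of_real (x - x0) ^ k) sums g x"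
      using assms unfolding real_analytic_def by blast
    have "(\<lambda>k. diffs c k * of_real (x - x0) ^ k) sums g' x" if "\<bar>x - x0\<bar> < \<rho>" for x
      using *[OF c that] by (auto simp: g'_def sums_iff vector_derivative_at)
    thus "\<exists>\<rho>>0. \<exists>c. \<forall>x. \<bar>x - x0\<bar> < \<rho> \<longrightarrow> (\<lambda>k. c k * of_real (x - x0) ^ k) sums g' x"
      using \<rho> by blast
  qed
  show "(g has_vector_derivative g' x) (at x)" for x
  proof -
    obtain \<rho> c where \<rho>: "\<rho> > 0" and c: "\<forall>y. \<bar>y - x\<bar> < \<rho> \<longrightarrow> (\<lambda>k. c k * of_real (y - x) ^ k) sums g y"
      using assms unfolding real_analytic_def by blast
    show ?thesis
      using *[OF c, of x] \<rho> by (auto simp: g'_def vector_derivative_at)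
  qed
qed

subsection \<open>Fourier series of periodic functions\<close>

definition fourier_coeff :: "(real \<Rightarrow> complex) \<Rightarrow> int \<Rightarrow> complex" where
  "fourier_coeff f k = integral {0..1} (\<lambda>x. f x * echar (- of_int k * x))"

text \<open>Integration by parts: both \<open>f\<close> and the character are 1-periodic, so the
  boundary term vanishes.\<close>

lemma fourier_coeff_deriv:
  assumes per: "\<And>x. f (x + 1) = f x"
    and deriv: "\<And>x. (f has_vector_derivative f' x) (at x)"
    and cont: "continuous_on UNIV f'"
  shows "fourier_coeff f' k = 2 * pi * of_int k * \<i> * fourier_coeff f k"
proof -
  have contf: "continuous_on S f" for S
    using deriv by (meson continuous_at_imp_continuous_on has_vector_derivative_continuous)
  have contf': "continuous_on S f'" for S
    using cont continuous_on_subset by blast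
  define e where "e = (\<lambda>x. echar (- of_int k * x))"
  have e: "(e has_vector_derivative 2 * pi * (- of_int k) * \<i> * e x) (at x within S)" for x S
    using has_vector_derivative_echar_mult[of "- of_int k" x S] by (simp add: e_def)
  have conte: "continuous_on S e" for S
    unfolding e_def by (intro continuous_intros)
  have 1: "((\<lambda>x. f x * (2 * pi * (- of_int k) * \<i> * e x) + f' x * e x) has_integral f 1 * e 1 - f 0 * e 0) {0..1}"
    by (intro fundamental_theorem_of_calculus zero_le_one has_vector_derivative_mult e
          has_vector_derivative_at_within[OF deriv])
  have "e 1 = 1" using echar_of_int[of "-k"] by (simp add: e_def)
  moreover have "f 1 = f 0" using per[of 0] by simp
  ultimately have "f 1 * e 1 - f 0 * e 0 = 0" by (simp add: e_def)
  hence "0 = integral {0..1} (\<lambda>x. (2 * pi * (- of_int k) * \<i>) * (f x * e x) + f' x * e x)"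
    using 1 by (simp add: integral_unique algebra_simps)
  also have "\<dots> = integral {0..1} (\<lambda>x. (2 * pi * (- of_int k) * \<i>) * (f x * e x)) + integral {0..1} (\<lambda>x. f' x * e x)"
    by (intro integral_add integrable_continuous_interval continuous_intros contf contf' conte)
  also have "\<dots> = (2 * pi * (- of_int k) * \<i>) * fourier_coeff f k + fourier_coeff f' k"
    unfolding fourier_coeff_def e_def by (subst integral_mult_right) auto
  finally show ?thesis by (simp add: algebra_simps add_eq_0_iff)
qed

lemma real_analytic_continuous_on:
  assumes "real_analytic g"
  shows "continuous_on S g"
  using real_analytic_deriv[OF assms]
  by (meson continuous_at_imp_continuous_on has_vector_derivative_continuous)

lemma fourier_coeff_bounded:
  assumes "continuous_on UNIV f"
  shows "\<exists>B. \<forall>k. norm (fourier_coeff f k) \<le> B"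
proof -
  have cont: "continuous_on {0..1} f" 
    using assms continuous_on_subset by blast
  then obtain B where B: "\<And>x. x \<in> {0..1} \<Longrightarrow> norm (f x) \<le> B"
    using compact_continuous_image[OF cont] 
    by (metis compact_Icc compact_imp_bounded bounded_iff image_eqI)
  have "norm (fourier_coeff f k) \<le> B * (1 - 0)" for k
    unfolding fourier_coeff_def
    by (rule integral_bound) (auto intro!: continuous_intros cont simp: norm_mult B)
  thus ?thesis by auto
qed

lemma periodic_deriv:
  fixes f :: "real \<Rightarrow> 'a::real_normed_vector"
  assumes "\<And>x. f (x + p) = f x" and deriv: "\<And>x. (f has_vector_derivative f' x) (at x)"
  shows "f' (x + p) = f' x"
proof -
  have "((\<lambda>x. x + p) has_vector_derivative 1) (at x)"
    by (auto intro!: derivative_eq_intros)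
  from vector_diff_chain_at[OF this deriv[of "x + p"]]
  have "(f has_vector_derivative f' (x + p)) (at x)"
    by (simp add: o_def assms(1))
  thus ?thesis
    using deriv vector_derivative_unique_at by blast
qed

lemma periodic_of_int:
  fixes f :: "real \<Rightarrow> 'a"
  assumes "\<And>x. f (x + 1) = f x"
  shows "f (x + of_int n) = f x"
proof -
  have nat: "f (x + of_nat m) = f x" for m x
    by (induction m) (use assms[of "x + of_nat _"] in \<open>simp_all add: add_ac\<close>)
  show ?thesis
    using nat[of x "nat n"] nat[of "x + of_int n" "nat (- n)"] by (cases "n \<ge> 0") auto
qed

text \<open>Each integration by parts gains one factor |k|. The induction varies \<open>g\<close>,
  since the step applies the claim for m to the derivative.\<close>

lemma fourier_coeff_decay:
  assumes "\<And>x. g (x + 1) = g x" "real_analytic g"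
  shows "\<exists>B. \<forall>k. norm (fourier_coeff g k) * \<bar>of_int k\<bar> ^ m \<le> B"
  using assms
proof (induction m arbitrary: g)
  case 0
  then show ?case
    using fourier_coeff_bounded[OF real_analytic_continuous_on[OF 0(2)]] by simp
next
  case (Suc m)
  obtain g' where g': "real_analytic g'" "\<And>x. (g has_vector_derivative g' x) (at x)"
    using real_analytic_deriv[OF Suc.prems(2)] by blast
  from Suc.IH[OF periodic_deriv[OF Suc.prems(1) g'(2)] g'(1)] obtain B where 
    B: "\<And>k. norm (fourier_coeff g' k) * \<bar>of_int k\<bar> ^ m \<le> B" by auto
  have "norm (fourier_coeff g k) * \<bar>of_int k\<bar> ^ Suc m \<le> B" for k
  proof -
    have "norm (fourier_coeff g' k) = 2 * pi * \<bar>of_int k\<bar> * norm (fourier_coeff g k)"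
      using fourier_coeff_deriv[OF Suc.prems(1) g'(2) real_analytic_continuous_on[OF g'(1)]]
      by (simp add: norm_mult)
    hence "2 * pi * (norm (fourier_coeff g k) * \<bar>of_int k\<bar> ^ Suc m) \<le> B"
      using B[of k] by (simp add: algebra_simps)
    moreover have "1 * (norm (fourier_coeff g k) * \<bar>of_int k\<bar> ^ Suc m) \<le> 
      2 * pi * (norm (fourier_coeff g k) * \<bar>of_int k\<bar> ^ Suc m)"
      using pi_ge_two by (intro mult_right_mono) auto
    ultimately show ?thesis by simp
  qed
  thus ?case by blast
qed

text \<open>The part of [t, 1 + t] that sticks out beyond 1 is moved back by one period.\<close>

lemma integral_periodic_shift:
  fixes f :: "real \<Rightarrow> 'a::banach"
  assumes per: "\<And>x. f (x + 1) = f x" and cont: "continuous_on UNIV f"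
    and t: "0 \<le> t" "t \<le> 1"
  shows "integral {0..1} (\<lambda>x. f (x + t)) = integral {0..1} f"
proof -
  have int: "f integrable_on {a..b}" for a b
    by (intro integrable_continuous_interval continuous_on_subset[OF cont]) auto
  have "integral {0..1} (\<lambda>x. f (x + t)) = integral {t..1 + t} f"
    using integral_shift_real_ivl[of t t "1 + t" f] by simp
  also have "\<dots> = integral {t..1} f + integral {1..1 + t} f"
    using t by (intro Henstock_Kurzweil_Integration.integral_combine[symmetric] int) auto
  also have "integral {1..1 + t} f = integral {0..t} (\<lambda>x. f (x + 1))"
    using integral_shift_real_ivl[of 1 1 "1 + t" f] by simp
  also have "\<dots> = integral {0..t} f"
    by (simp add: per)
  also have "integral {t..1} f + integral {0..t} f = integral {0..1} f"
    using t by (subst add.commute) (intro Henstock_Kurzweil_Integration.integral_combine int; simp)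
  finally show ?thesis .
qed

text \<open>Translating the integrand by half a period of the character changes the sign of the
  character, so that the Fourier coefficient is controlled by the modulus of continuity of \<open>f\<close>.\<close>

lemma riemann_lebesgue:
  assumes per: "\<And>x. f (x + 1) = f x" and cont: "continuous_on UNIV f" and "\<epsilon> > 0"
  shows "\<exists>M. \<forall>k. \<bar>k\<bar> \<ge> M \<longrightarrow> norm (fourier_coeff f k) < \<epsilon>"
proof -
  have contf: "continuous_on S f" for S
    using cont continuous_on_subset by blast
  \<comment> \<open>The interval must contain x + t for x in [0, 1] and t <= 1.\<close>
  have "uniformly_continuous_on {0..2} f"
    by (intro compact_uniformly_continuous contf) auto
  then obtain d where d: "d > 0"
    "\<And>x y. x \<in> {0..2} \<Longrightarrow> y \<in> {0..2} \<Longrightarrow> dist x y < d \<Longrightarrow> dist (f x) (f y) < \<epsilon>"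
    using \<open>\<epsilon> > 0\<close> unfolding uniformly_continuous_on_def by metis
  \<comment> \<open>The 1 excludes k = 0, which has no half period; 1/d makes the half period
    1/(2|k|) smaller than d.\<close>
  define M where "M = max 1 \<lceil>1 / d\<rceil>"
  have "norm (fourier_coeff f k) < \<epsilon>" if k: "\<bar>k\<bar> \<ge> M" for k
  proof -
    define t where "t = 1 / (2 * \<bar>of_int k\<bar> :: real)"
    have k1: "\<bar>of_int k\<bar> \<ge> (1::real)" and kd: "\<bar>of_int k\<bar> \<ge> 1 / d"
      using k by (auto simp: M_def ceiling_le_iff simp flip: of_int_abs)
    have t: "0 \<le> t" "t \<le> 1" 
      using k1 by (auto simp: t_def field_simps)
    have "t < 1 / \<bar>of_int k\<bar>"
      using k1 by (simp add: t_def field_simps)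
    also have "\<dots> \<le> d"
      using kd k1 d(1) by (simp add: field_simps)
    finally have "t < d" .
    have kt: "- of_int k * t = 1 / 2 \<or> - of_int k * t = - (1 / 2)"
      using k1 by (cases "k \<ge> 0") (auto simp: t_def field_simps)
    have half: "echar (- of_int k * t) = -1"
      using kt
    proof
      assume "- of_int k * t = 1 / 2"
      thus ?thesis unfolding echar_def by (simp only:) simp
    next
      assume "- of_int k * t = - (1 / 2)"
      thus ?thesis unfolding echar_def by (simp only:) (simp add: complex_eq_iff)
    qed
    define p where "p = (\<lambda>x. f x * echar (- of_int k * x))"
    have contp: "continuous_on S p" for S
      unfolding p_def by (intro continuous_intros contf)
    have "p (x + 1) = p x" for x
      using echar_of_int[of "-k"] by (simp add: p_def per ring_distribs echar_add echar_diff)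
    hence "fourier_coeff f k = integral {0..1} (\<lambda>x. p (x + t))"
      using integral_periodic_shift[OF _ contp t] by (simp add: fourier_coeff_def p_def)
    hence "2 * fourier_coeff f k = integral {0..1} p + integral {0..1} (\<lambda>x. p (x + t))"
      by (simp add: fourier_coeff_def p_def)
    also have "\<dots> = integral {0..1} (\<lambda>x. p x + p (x + t))"
      by (intro integral_add[symmetric] integrable_continuous_interval contp
            continuous_on_compose2[OF contp[of UNIV]] continuous_intros) auto
    also have "(\<lambda>x. p x + p (x + t)) = (\<lambda>x. (f x - f (x + t)) * echar (- of_int k * x))"
    proof
      fix x
      have "echar (- of_int k * (x + t)) = - echar (- of_int k * x)"
        using half by (simp only: distrib_left echar_add) simp
      thus "p x + p (x + t) = (f x - f (x + t)) * echar (- of_int k * x)"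
        by (simp only: p_def) (simp add: algebra_simps)
    qed
    finally have eq: "2 * fourier_coeff f k = 
      integral {0..1} (\<lambda>x. (f x - f (x + t)) * echar (- of_int k * x))" .
    have "norm (2 * fourier_coeff f k) \<le> \<epsilon> * (1 - 0)"
      unfolding eq
    proof (rule integral_bound)
      show "continuous_on {0..1} (\<lambda>x. (f x - f (x + t)) * echar (- of_int k * x))"
        by (intro continuous_intros contf continuous_on_compose2[OF contf[of UNIV]]) auto
      show "norm ((f x - f (x + t)) * echar (- of_int k * x)) \<le> \<epsilon>" if "x \<in> {0..1}" for x
        using d(2)[of x "x + t"] that t \<open>t < d\<close> by (simp add: norm_mult dist_norm)
    qed auto
    thus ?thesis using \<open>\<epsilon> > 0\<close> by (simp add: norm_mult)
  qed
  thus ?thesis by blast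
qed

text \<open>For k nonzero, the derivative rule applied to a constant reads 0 = 2 pi i k times the
  coefficient.\<close>

lemma fourier_coeff_const: "fourier_coeff (\<lambda>_. c) k = (if k = 0 then c else 0)"
proof (cases "k = 0")
  case False
  have "fourier_coeff (\<lambda>_. 0) k = 2 * pi * of_int k * \<i> * fourier_coeff (\<lambda>_. c) k"
    by (rule fourier_coeff_deriv) (auto intro!: derivative_eq_intros)
  moreover have "fourier_coeff (\<lambda>_. 0) k = 0"
    by (simp add: fourier_coeff_def)
  ultimately show ?thesis using False by simp
qed (simp add: fourier_coeff_def)

text \<open>Chernoff's argument: the quotient \<open>f x = (g x - g x0) / (echar (x - x0) - 1)\<close> extends
  continuously to the circle, and \<open>g x = g x0 + f x * (echar (x - x0) - 1)\<close> turns the Fourier series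
  of \<open>g\<close> at \<open>x0\<close> into a telescoping series.\<close>

lemma fourier_series_sums:
  fixes g :: "real \<Rightarrow> complex" and x0 :: real
  assumes per: "\<And>x. g (x + 1) = g x"
    and deriv: "\<And>x. (g has_vector_derivative g' x) (at x)"
  defines "a \<equiv> \<lambda>k. fourier_coeff g k * echar (of_int k * x0)"
  shows "(\<lambda>k. a (int (Suc k)) + a (- int (Suc k))) sums (g x0 - fourier_coeff g 0)"
proof -
  \<comment> \<open>The value at the zeros of the denominator is the limit of the quotient there, as
    2 pi i is the derivative of the denominator.\<close>
  define f where "f = (\<lambda>x. if echar (x - x0) = 1 then g' x / (2 * pi * \<i>)
                           else (g x - g x0) / (echar (x - x0) - 1))"
  have contg: "continuous_on S g" for S
    using deriv by (meson continuous_at_imp_continuous_on has_vector_derivative_continuous)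
  have quot: "g x = g x0" if "echar (x - x0) = 1" for x
  proof -
    from that obtain n where "x - x0 = of_int n"
      by (auto simp: echar_eq_1_iff elim: Ints_cases)
    thus ?thesis using periodic_of_int[of g x0 n, OF per] by (simp add: algebra_simps)
  qed
  have g_eq: "g x = g x0 + f x * (echar (x - x0) - 1)" for x
    using quot[of x] by (simp add: f_def)
  have perf: "f (x + 1) = f x" for x
  proof -
    have "echar (x + 1 - x0) = echar (x - x0)"
      using echar_add[of "x - x0" 1] echar_of_int[of 1] by (simp add: algebra_simps)
    thus ?thesis
      unfolding f_def by (simp only: per periodic_deriv[OF per deriv])
  qed
  have "isCont f x" for x
  proof (cases "echar (x - x0) = 1")
    case False
    have "open {y. echar (y - x0) \<noteq> 1}"
      by (intro open_Collect_neq continuous_intros)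
    hence "\<forall>\<^sub>F y in nhds x. f y = (g y - g x0) / (echar (y - x0) - 1)"
      using False by (auto simp: f_def eventually_nhds intro!: exI[of _ "{y. echar (y - x0) \<noteq> 1}"])
    moreover have "continuous_on {y. echar (y - x0) \<noteq> 1} (\<lambda>y. (g y - g x0) / (echar (y - x0) - 1))"
      by (intro continuous_intros contg) auto
    hence "isCont (\<lambda>y. (g y - g x0) / (echar (y - x0) - 1)) x"
      using False \<open>open {y. echar (y - x0) \<noteq> 1}\<close> by (subst (asm) continuous_on_eq_continuous_at) auto
    ultimately show ?thesis by (subst isCont_cong)
  next
    case True
    have e_eq: "echar (y - x0) = echar (y - x)" for y
      using True echar_add[of "y - x" "x - x0"] by simp
    have lim: "((\<lambda>y. (h y - h x) / of_real (y - x)) \<longlongrightarrow> h') (at x)"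
      if "(h has_vector_derivative h') (at x)" for h :: "real \<Rightarrow> complex" and h'
    proof -
      have "((\<lambda>y. norm ((h y - h x) - (y - x) *\<^sub>R h') / norm (y - x)) \<longlongrightarrow> 0) (at x)"
        using that by (simp add: has_vector_derivative_def has_derivative_iff_norm)
      moreover have "\<forall>\<^sub>F y in at x. norm ((h y - h x) - (y - x) *\<^sub>R h') / norm (y - x) =
                       norm ((h y - h x) / of_real (y - x) - h')"
        unfolding eventually_at_topological
      proof (intro exI[of _ UNIV] conjI ballI impI)
        fix y assume "y \<noteq> x"
        hence "(h y - h x) / of_real (y - x) - h' = ((h y - h x) - (y - x) *\<^sub>R h') / of_real (y - x)"
          by (simp add: divide_simps scaleR_conv_of_real)
        thus "norm ((h y - h x) - (y - x) *\<^sub>R h') / norm (y - x) = norm ((h y - h x) / of_real (y - x) - h')"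
          by (simp only: norm_divide norm_of_real real_norm_def)
      qed auto
      ultimately have "((\<lambda>y. norm ((h y - h x) / of_real (y - x) - h')) \<longlongrightarrow> 0) (at x)"
        by (rule Lim_transform_eventually)
      thus ?thesis
        by (simp only: tendsto_norm_zero_iff LIM_zero_iff)
    qed
    have "((\<lambda>y. echar (1 * y + (- x))) has_vector_derivative 2 * pi * \<i> * echar (1 * x + (-x))) (at x)"
      unfolding echar_add using has_vector_derivative_echar_mult[of 1 x UNIV]
      by (auto intro!: derivative_eq_intros)
    hence 1: "((\<lambda>y. (echar (y - x) - 1) / of_real (y - x)) \<longlongrightarrow> 2 * pi * \<i>) (at x)"
      using lim[of "\<lambda>y. echar (y - x)" "2 * pi * \<i>"] by simp
    \<comment> \<open>Near a zero of the denominator, \<open>f\<close> is a quotient of two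
      difference quotients, and the lower one has a nonzero limit.\<close>
    have "((\<lambda>y. ((g y - g x) / of_real (y - x)) / ((echar (y - x) - 1) / of_real (y - x)))
             \<longlongrightarrow> g' x / (2 * pi * \<i>)) (at x)"
      by (intro tendsto_divide lim deriv 1) auto
    moreover have "\<forall>\<^sub>F y in at x. (echar (y - x) - 1) / of_real (y - x) \<noteq> 0"
      by (rule tendsto_imp_eventually_ne[OF 1]) simp
    hence "\<forall>\<^sub>F y in at x. ((g y - g x) / of_real (y - x)) / ((echar (y - x) - 1) / of_real (y - x)) = f y"
      by eventually_elim (auto simp: f_def e_eq quot[OF True])
    ultimately have "(f \<longlongrightarrow> g' x / (2 * pi * \<i>)) (at x)"
      by (rule Lim_transform_eventually)
    thus ?thesis using True by (simp add: isCont_def f_def)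
  qed
  hence contf: "continuous_on S f" for S
    by (simp add: continuous_at_imp_continuous_on)
  define F where "F = (\<lambda>k. fourier_coeff f k * echar (of_int k * x0))"
  \<comment> \<open>Multiplication by \<open>echar x\<close> shifts the frequency by one, and the
    weight \<open>echar (of_int k * x0)\<close> in \<open>F\<close> absorbs the factor
    \<open>echar (- x0)\<close>.\<close>
  have a_eq: "a k = (if k = 0 then g x0 else 0) + F (k - 1) - F k" for k
  proof -
    have "(\<lambda>x. g x * echar (- of_int k * x)) = (\<lambda>x. g x0 * echar (- of_int k * x) +
            (echar (- x0) * (f x * echar (- of_int (k - 1) * x)) - f x * echar (- of_int k * x)))"
    proof
      fix x
      have "- real_of_int (k - 1) * x = x + (- of_int k * x)" by (simp add: algebra_simps)
      hence "echar (- of_int (k - 1) * x) = echar x * echar (- of_int k * x)"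
        by (simp only: echar_add)
      moreover have "echar (x - x0) = echar x * echar (- x0)"
        using echar_add[of x "-x0"] by simp
      ultimately show "g x * echar (- of_int k * x) = g x0 * echar (- of_int k * x) +
            (echar (- x0) * (f x * echar (- of_int (k - 1) * x)) - f x * echar (- of_int k * x))"
        by (subst g_eq[of x]) (simp only: ring_distribs, simp add: mult_ac)
    qed
    hence "fourier_coeff g k = integral {0..1} (\<lambda>x. g x0 * echar (- of_int k * x) +
            (echar (- x0) * (f x * echar (- of_int (k - 1) * x)) - f x * echar (- of_int k * x)))"
      by (simp only: fourier_coeff_def)
    also have "\<dots> = integral {0..1} (\<lambda>x. g x0 * echar (- of_int k * x)) +
            integral {0..1} (\<lambda>x. echar (- x0) * (f x * echar (- of_int (k - 1) * x)) - f x * echar (- of_int k * x))"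
      by (intro integral_add integrable_continuous_interval continuous_intros contf)
    also have "integral {0..1} (\<lambda>x. echar (- x0) * (f x * echar (- of_int (k - 1) * x)) - f x * echar (- of_int k * x))
      = integral {0..1} (\<lambda>x. echar (- x0) * (f x * echar (- of_int (k - 1) * x))) - integral {0..1} (\<lambda>x. f x * echar (- of_int k * x))"
      by (intro integral_diff integrable_continuous_interval continuous_intros contf)
    also have "integral {0..1} (\<lambda>x. echar (- x0) * (f x * echar (- of_int (k - 1) * x))) = echar (- x0) * fourier_coeff f (k - 1)"
      unfolding fourier_coeff_def by (rule integral_mult_right)
    also have "integral {0..1} (\<lambda>x. g x0 * echar (- of_int k * x)) = (if k = 0 then g x0 else 0)"
      using fourier_coeff_const[of "g x0" k] by (simp add: fourier_coeff_def)
    finally have eq: "fourier_coeff g k = (if k = 0 then g x0 else 0) + 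
        (echar (- x0) * fourier_coeff f (k - 1) - fourier_coeff f k)"
      by (simp add: fourier_coeff_def)
    have "a k = (if k = 0 then g x0 else 0) + 
        fourier_coeff f (k - 1) * (echar (of_int k * x0) * echar (- x0)) - F k"
      unfolding a_def F_def eq by (cases "k = 0") (simp_all add: algebra_simps)
    moreover have "echar (of_int k * x0) * echar (- x0) = echar (of_int (k - 1) * x0)"
      by (simp add: algebra_simps flip: echar_add)
    ultimately show ?thesis
      by (simp add: F_def)
  qed
  \<comment> \<open>Frequency 0 is left out, so two telescoping sums remain, over 1..N and over
    -N..-1. The outer ends vanish in the limit by Riemann-Lebesgue for \<open>f\<close>;
    \<open>a_eq\<close> at 0 evaluates the inner ends.\<close>
  have partial: "(\<Sum>k<N. a (int (Suc k)) + a (- int (Suc k))) = F 0 - F (int N) + F (- int (Suc N)) - F (-1)" for N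
    by (induction N) (simp_all add: a_eq algebra_simps)
  have F0: "(\<lambda>N. F (h N)) \<longlonglongrightarrow> 0" if h: "\<And>N. \<bar>h N\<bar> \<ge> int N" for h :: "nat \<Rightarrow> int"
    unfolding tendsto_iff
  proof (intro allI impI)
    fix \<epsilon> :: real assume "\<epsilon> > 0"
    then obtain M where M: "\<And>k. \<bar>k\<bar> \<ge> M \<Longrightarrow> norm (fourier_coeff f k) < \<epsilon>"
      using riemann_lebesgue[OF perf contf] by blast
    show "\<forall>\<^sub>F N in sequentially. dist (F (h N)) 0 < \<epsilon>"
      using eventually_ge_at_top[of "nat M"]
    proof eventually_elim
      case (elim N)
      thus ?case using M[of "h N"] h[of N] by (simp add: F_def norm_mult)
    qed
  qed
  have "(\<lambda>N. F 0 - F (int N) + F (- int (Suc N)) - F (-1)) \<longlonglongrightarrow> F 0 - 0 + 0 - F (-1)"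
    by (intro tendsto_intros F0) auto
  moreover have "F 0 - 0 + 0 - F (-1) = g x0 - fourier_coeff g 0"
    using a_eq[of 0] by (simp add: a_def)
  ultimately show ?thesis
    unfolding sums_def partial by simp
qed

subsection \<open>Small divisors\<close>

text \<open>The distance of k \<alpha> to the nearest integer is |k| times the error of
  approximating \<alpha> with denominator |k|, so one power of |k| is regained from the exponent 1 +
  r.\<close>

lemma diophantine_norm_echar_ge:
  assumes "diophantine_of_type r \<alpha>"
  shows "\<exists>C>0. \<forall>k. k \<noteq> 0 \<longrightarrow> norm (echar (of_int k * \<alpha>) - 1) \<ge> C * \<bar>of_int k\<bar> powr (- r)"
proof -
  obtain C where C: "C > 0"
    "\<And>p q. q \<ge> 1 \<Longrightarrow> \<bar>\<alpha> - real_of_int p / real q\<bar> \<ge> C / real q powr (1 + r)"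
    using assms unfolding diophantine_of_type_def by blast
  have "norm (echar (of_int k * \<alpha>) - 1) \<ge> (2 * C) * \<bar>of_int k\<bar> powr (- r)" if "k \<noteq> 0" for k
  proof -
    define q where "q = nat \<bar>k\<bar>"
    define m where "m = round (of_int k * \<alpha>)"
    have q: "q \<ge> 1" "real q = \<bar>of_int k\<bar>"
      using that by (auto simp: q_def)
    have "C * real q powr (- r) = real q * (C / real q powr (1 + r))"
      using q by (simp add: powr_add powr_minus field_simps)
    \<comment> \<open>Denominators are positive, so the sign of k moves into the numerator.\<close>
    also have "\<dots> \<le> real q * \<bar>\<alpha> - real_of_int (sgn k * m) / real q\<bar>"
      by (intro mult_left_mono C q) auto
    also have "\<dots> = \<bar>real q * (\<alpha> - real_of_int (sgn k * m) / real q)\<bar>"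
      by (simp add: abs_mult)
    also have "real q * (\<alpha> - real_of_int (sgn k * m) / real q) = real q * \<alpha> - real_of_int (sgn k * m)"
      using q(1) by (simp add: field_simps)
    also have "\<bar>\<dots>\<bar> = \<bar>of_int k * \<alpha> - of_int m\<bar>"
      using q that by (cases "k > 0") (auto simp: abs_if)
    finally show ?thesis
      using norm_echar_minus_one_ge[of "of_int k * \<alpha>"] q by (simp add: m_def)
  qed
  thus ?thesis using C(1) by (intro exI[of _ "2 * C"]) auto
qed

text \<open>A fraction equal to \<alpha> would have error 0, below the positive Diophantine
  bound.\<close>

lemma diophantine_irrational:
  assumes "diophantine \<alpha>"
  shows "\<alpha> \<notin> \<rat>"
proof
  assume "\<alpha> \<in> \<rat>"
  then obtain a b where ab: "b > 0" "\<alpha> = of_int a / of_int b"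
    by (meson Rats_cases')
  obtain r C where C: "C > 0"
    "\<And>p q. q \<ge> 1 \<Longrightarrow> \<bar>\<alpha> - real_of_int p / real q\<bar> \<ge> C / real q powr (1 + r)"
    using assms unfolding diophantine_def diophantine_of_type_def by blast
  have "C / real (nat b) powr (1 + r) \<le> 0"
    using C(2)[of "nat b" a] ab by simp
  moreover have "C / real (nat b) powr (1 + r) > 0"
    using C(1) ab by simp
  ultimately show False by simp
qed

lemma norm_geometric_sum_le:
  fixes z :: "'a::real_normed_field"
  assumes "norm z = 1" "z \<noteq> 1"
  shows "norm (\<Sum>n<N. z ^ Suc n) \<le> 2 / norm (z - 1)"
proof -
  have "(\<Sum>n<N. z ^ Suc n) = z * ((z ^ N - 1) / (z - 1))"
    using assms by (simp add: geometric_sum flip: sum_distrib_left)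
  moreover have "norm (z ^ N - 1) \<le> 2"
    using norm_triangle_ineq4[of "z ^ N" 1] assms by (simp add: norm_power)
  ultimately show ?thesis
    using assms by (simp add: norm_mult norm_divide divide_right_mono)
qed

text \<open>For fixed N only finitely many Fourier series are added, so the order of summation can
  be exchanged freely. The resulting terms \<open>D N k\<close> have a majorant \<open>h\<close>
  independent of N.\<close>

lemma bounded_birkhoff_sums:
  assumes per: "\<And>x. g (x + 1) = g x" and ana: "real_analytic g"
    and mean: "integral {0..1} g = 0" and dio: "diophantine_of_type r \<alpha>"
  shows "\<exists>M. \<forall>N. norm (\<Sum>n<N. g (real (Suc n) * \<alpha>)) \<le> M"
proof -
  obtain C where C: "C > 0"
    "\<And>k. k \<noteq> 0 \<Longrightarrow> norm (echar (of_int k * \<alpha>) - 1) \<ge> C * \<bar>of_int k\<bar> powr (- r)"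
    using diophantine_norm_echar_ge[OF dio] by blast
  \<comment> \<open>The order r compensates the small divisor, and 2 more make the series over k
    converge.\<close>
  define m where "m = nat \<lceil>r\<rceil> + 2"
  have m: "real m \<ge> r + 2"
    unfolding m_def using real_nat_ceiling_ge[of r] by simp
  obtain B where B: "\<And>k. norm (fourier_coeff g k) * \<bar>of_int k\<bar> ^ m \<le> B"
    using fourier_coeff_decay[OF per ana] by blast
  have "B \<ge> 0" using B[of 0] by (simp add: m_def)
  obtain g' where g': "\<And>x. (g has_vector_derivative g' x) (at x)"
    using real_analytic_deriv[OF ana] by blast
  define D where "D = (\<lambda>N k. fourier_coeff g k * (\<Sum>n<N. echar (of_int k * (real (Suc n) * \<alpha>))))"
  \<comment> \<open>Twice the bound 2 B / C, for the two frequencies of equal modulus.\<close>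
  define h where "h = (\<lambda>k. 4 * B / C * real (Suc k) powr (-2))"
  have D: "norm (D N k) \<le> 2 * B / C * \<bar>of_int k\<bar> powr (-2)" if "k \<noteq> 0" for N k
  proof -
    define K where "K = \<bar>real_of_int k\<bar>"
    define z where "z = echar (of_int k * \<alpha>)"
    have K: "K \<ge> 1" using that by (auto simp: K_def simp flip: of_int_abs)
    have z: "norm (z - 1) \<ge> C * K powr (- r)" "C * K powr (-r) > 0"
      using C that K by (auto simp: z_def K_def)
    hence "z \<noteq> 1" by auto
    have "(\<Sum>n<N. echar (of_int k * (real (Suc n) * \<alpha>))) = (\<Sum>n<N. z ^ Suc n)"
      unfolding z_def echar_of_nat_mult[symmetric] by (simp only: mult_ac)
    hence "norm (D N k) = norm (fourier_coeff g k) * norm (\<Sum>n<N. z ^ Suc n)"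
      by (simp add: D_def norm_mult)
    also have "\<dots> \<le> (B / K powr (r + 2)) * (2 / (C * K powr (- r)))"
    proof (intro mult_mono)
      have "norm (fourier_coeff g k) * K powr (r + 2) \<le> norm (fourier_coeff g k) * K ^ m"
        using K m by (intro mult_left_mono) (auto intro!: powr_mono simp flip: powr_realpow)
      also have "\<dots> \<le> B" using B[of k] by (simp add: K_def)
      finally show "norm (fourier_coeff g k) \<le> B / K powr (r + 2)"
        using K by (simp add: field_simps)
      have "norm (\<Sum>n<N. z ^ Suc n) \<le> 2 / norm (z - 1)"
        using \<open>z \<noteq> 1\<close> by (intro norm_geometric_sum_le) (auto simp: z_def)
      also have "\<dots> \<le> 2 / (C * K powr (- r))"
        using z \<open>z \<noteq> 1\<close> by (intro divide_left_mono mult_pos_pos[of "norm (z - 1)"]) auto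
      finally show "norm (\<Sum>n<N. z ^ Suc n) \<le> 2 / (C * K powr (- r))" .
    qed (use \<open>B \<ge> 0\<close> in auto)
    also have "\<dots> = 2 * B / C * (1 / (K powr (r + 2) * K powr (- r)))"
      by (simp add: mult_ac)
    also have "\<dots> = 2 * B / C * K powr (-2)"
      using powr_add[of K "r + 2" "- r"] powr_minus_divide[of K 2] by simp
    finally show ?thesis by (simp add: K_def)
  qed
  have sumh: "summable h"
    unfolding h_def using summable_real_powr_iff[of "-2"]
    by (intro summable_mult) (subst summable_Suc_iff[of "\<lambda>k. real k powr (-2)"], simp)
  have "norm (\<Sum>n<N. g (real (Suc n) * \<alpha>)) \<le> suminf h" for N
  proof -
    have "(\<lambda>k. \<Sum>n<N. fourier_coeff g (int (Suc k)) * echar (of_int (int (Suc k)) * (real (Suc n) * \<alpha>)) +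
            fourier_coeff g (- int (Suc k)) * echar (of_int (- int (Suc k)) * (real (Suc n) * \<alpha>)))
          sums (\<Sum>n<N. g (real (Suc n) * \<alpha>) - fourier_coeff g 0)"
      by (intro sums_sum fourier_series_sums[OF per g'])
    moreover have "fourier_coeff g 0 = 0"
      using mean by (simp add: fourier_coeff_def)
    ultimately have sums: "(\<lambda>k. D N (int (Suc k)) + D N (- int (Suc k))) sums (\<Sum>n<N. g (real (Suc n) * \<alpha>))"
      unfolding D_def sum_distrib_left sum.distrib by simp
    have "norm (D N (int (Suc k)) + D N (- int (Suc k))) \<le> h k" for k
    proof -
      have "norm (D N (int (Suc k)) + D N (- int (Suc k))) \<le> norm (D N (int (Suc k))) + norm (D N (- int (Suc k)))"
        by (rule norm_triangle_ineq)
      also have "\<dots> \<le> 2 * B / C * \<bar>of_int (int (Suc k))\<bar> powr (-2) + 2 * B / C * \<bar>of_int (- int (Suc k))\<bar> powr (-2)"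
        by (intro add_mono D) auto
      also have "\<dots> = h k" by (simp add: h_def add.commute)
      finally show ?thesis .
    qed
    from norm_suminf_le[OF this sumh] show ?thesis
      using sums by (simp add: sums_iff)
  qed
  thus ?thesis by blast
qed

subsection \<open>Dirichlet series with bounded coefficient sums\<close>

text \<open>Mean value estimate on a segment of length 1: the derivative has modulus |s| x^(-Re s -
  1), largest at the left end. The extra power of k makes the differences summable for every Re s >
  0.\<close>

lemma norm_powr_diff_le:
  fixes s :: complex
  assumes "Re s > 0"
  shows "norm (of_nat (Suc k) powr (- s) - of_nat (Suc (Suc k)) powr (- s)) \<le> 
           norm s * real (Suc k) powr (- Re s - 1)"
proof -
  let ?S = "closed_segment (complex_of_real (Suc k)) (complex_of_real (Suc (Suc k)))"
  have S: "\<exists>x. z = of_real x \<and> x \<ge> real (Suc k)" if "z \<in> ?S" for z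
    using that unfolding closed_segment_of_real by (auto simp: closed_segment_eq_real_ivl)
  have "norm (complex_of_real (Suc k) powr (- s) - complex_of_real (Suc (Suc k)) powr (- s)) \<le> 
          (norm s * real (Suc k) powr (- Re s - 1)) * norm (complex_of_real (Suc k) - complex_of_real (Suc (Suc k)))"
  proof (rule field_differentiable_bound[where S = ?S and f' = "\<lambda>z. - s * z powr (- s - 1)"])
    fix z assume "z \<in> ?S"
    then obtain x where x: "z = of_real x" "x \<ge> real (Suc k)" using S by blast
    have "z \<notin> \<real>\<^sub>\<le>\<^sub>0" using x by auto
    thus "((\<lambda>z. z powr (- s)) has_field_derivative - s * z powr (- s - 1)) (at z within ?S)"
      by (rule DERIV_subset[OF has_field_derivative_powr]) auto
    have "norm (z powr (- s - 1)) = x powr (- Re s - 1)"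
      using x by (subst norm_powr_real_powr) auto
    also have "\<dots> \<le> real (Suc k) powr (- Re s - 1)"
      using x assms by (intro powr_mono2') auto
    finally show "norm (- s * z powr (- s - 1)) \<le> norm s * real (Suc k) powr (- Re s - 1)"
      by (simp add: norm_mult mult_left_mono)
  qed auto
  also have "norm (complex_of_real (Suc k) - complex_of_real (Suc (Suc k))) = 1"
    by (simp add: norm_minus_commute)
  finally show ?thesis by simp
qed

text \<open>Abel summation replaces the series by one with terms \<open>f k s\<close>, which
  converges absolutely and locally uniformly; the comparison theorem for series of holomorphic
  functions then gives a holomorphic sum.\<close>

lemma dirichlet_series_bounded_sums:
  assumes M: "\<And>N. norm (\<Sum>k<N. a (Suc k)) \<le> M"
  shows "\<forall>s. Re s > 0 \<longrightarrow> summable (dirichlet_term a s)"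
    and "dirichlet_series a holomorphic_on {s. Re s > 0}"
proof -
  define A where "A = (\<lambda>N. \<Sum>k<N. a (Suc k))"
  define w where "w = (\<lambda>s k. (of_nat (Suc k) :: complex) powr (- s))"
  define f where "f = (\<lambda>k s. A (Suc k) * (w s k - w s (Suc k)))"
  define f' where "f' = (\<lambda>k s. A (Suc k) * (- Ln (of_nat (Suc k)) * w s k + Ln (of_nat (Suc (Suc k))) * w s (Suc k)))"
  let ?S = "{s. Re s > 0}"
  have "M \<ge> 0" using M[of 0] by simp
  have normf: "norm (f k s) \<le> M * (norm s * real (Suc k) powr (- Re s - 1))" if "Re s > 0" for k s
    unfolding f_def w_def norm_mult A_def 
    by (intro mult_mono M norm_powr_diff_le that) (use \<open>M \<ge> 0\<close> in auto)
  have opn: "open ?S" by (simp add: open_halfspace_Re_gt)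
  have "\<exists>g g'. \<forall>x\<in>?S. (\<lambda>n. f n x) sums g x \<and> (\<lambda>n. f' n x) sums g' x \<and> (g has_field_derivative g' x) (at x)"
  proof (rule series_and_derivative_comparison_complex[OF opn])
    have "((\<lambda>x. w x k) has_field_derivative - Ln (of_nat (Suc k)) * w x k) (at x)" for x k
    proof -
      have "((\<lambda>x. of_nat (Suc k) powr x) has_field_derivative
              Ln (of_nat (Suc k)) * of_nat (Suc k) powr (- x)) (at (- x))"
        by (intro has_field_derivative_powr_right) (simp del: of_nat_Suc)
      from DERIV_chain2[OF this DERIV_minus[OF DERIV_ident]] show ?thesis
        by (simp add: w_def del: of_nat_Suc)
    qed
    from DERIV_cmult[OF DERIV_diff[OF this this]]
    show "(f n has_field_derivative f' n x) (at x)" for n x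
      unfolding f_def f'_def by (simp add: algebra_simps del: of_nat_Suc)
  next
    fix x assume "x \<in> ?S"
    hence x: "Re x > 0" by simp
    \<comment> \<open>On the ball of this radius Re y >= d, so one majorant with exponent -d - 1 <
      -1 serves all its points.\<close>
    define d where "d = Re x / 2"
    have "d > 0" using x by (simp add: d_def)
    define h where "h = (\<lambda>k. M * ((norm x + d) * real (Suc k) powr (- d - 1)))"
    have "summable h"
      unfolding h_def using summable_real_powr_iff[of "-d - 1"] x
      by (intro summable_mult) (subst summable_Suc_iff[of "\<lambda>k. real k powr (-d - 1)"], simp add: d_def)
    hence "summable (\<lambda>k. complex_of_real (h k))"
      by (rule summable_of_real)
    moreover have h0: "h k \<ge> 0" for k
      using \<open>M \<ge> 0\<close> x by (simp add: h_def d_def)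
    moreover have "norm (f k y) \<le> h k" if "y \<in> ball x d" "y \<in> ?S" for k y
    proof -
      have y: "norm (y - x) < d" using that by (simp add: dist_norm norm_minus_commute)
      have "norm y \<le> norm x + d"
        using y norm_triangle_ineq[of x "y - x"] by simp
      moreover have "Re y \<ge> d"
        using y abs_Re_le_cmod[of "y - x"] by (simp add: d_def)
      ultimately have "M * (norm y * real (Suc k) powr (- Re y - 1)) \<le> h k"
        unfolding h_def using \<open>M \<ge> 0\<close> \<open>d > 0\<close> by (intro mult_left_mono mult_mono powr_mono) auto
      thus ?thesis using normf[of y k] that by simp
    qed
    ultimately show "\<exists>d (h :: nat \<Rightarrow> complex). 0 < d \<and> summable h \<and> range h \<subseteq> \<real>\<^sub>\<ge>\<^sub>0 \<and>
        (\<forall>\<^sub>F n in sequentially. \<forall>y\<in>ball x d \<inter> ?S. norm (f n y) \<le> norm (h n))"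
      using \<open>d > 0\<close> by (intro exI[of _ d] exI[of _ "\<lambda>k. complex_of_real (h k)"]) auto
  qed
  then obtain G G' where G: "\<And>s. Re s > 0 \<Longrightarrow> (\<lambda>n. f n s) sums G s" 
    "\<And>s. Re s > 0 \<Longrightarrow> (G has_field_derivative G' s) (at s)"
    by auto
  have term_eq: "dirichlet_term a s k = a (Suc k) * w s k" for s k
    by (simp add: dirichlet_term_def w_def powr_minus divide_inverse)
  \<comment> \<open>Since \<open>w s N\<close> is (N + 1)^(-s), the boundary term is a bounded
    factor times a null sequence.\<close>
  have by_parts: "(\<Sum>k<N. dirichlet_term a s k) = (\<Sum>k<N. f k s) + A N * w s N" for s N
    by (induction N) (simp_all add: term_eq f_def A_def algebra_simps)
  have sums: "dirichlet_term a s sums G s" if s: "Re s > 0" for s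
  proof -
    have "(\<lambda>N. w s N) \<longlonglongrightarrow> 0"
      unfolding w_def using s by (intro tendsto_neg_powr_complex_of_nat filterlim_Suc) auto
    hence "(\<lambda>N. A N * w s N) \<longlonglongrightarrow> 0"
      by (rule lim_null_mult_left_bounded[where B = M, rotated]) (simp add: A_def M)
    from tendsto_add[OF G(1)[OF s, unfolded sums_def] this] show ?thesis
      by (simp add: sums_def by_parts)
  qed
  thus "\<forall>s. Re s > 0 \<longrightarrow> summable (dirichlet_term a s)"
    by (auto simp: sums_iff)
  have "G holomorphic_on ?S"
    using G(2) by (auto simp: holomorphic_on_open[OF opn])
  moreover have "dirichlet_series a s = G s" if "s \<in> ?S" for s
    using sums[of s] that by (simp add: dirichlet_series_def sums_iff)
  ultimately show "dirichlet_series a holomorphic_on ?S"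
    using holomorphic_transform by metis
qed

section \<open>Divergence for Re s < 0\<close>

lemma orbit_not_tendsto_0:
  fixes g :: "real \<Rightarrow> 'a::real_normed_vector"
  assumes per: "\<And>x. g (x + 1) = g x" and cont: "continuous_on UNIV g"
    and irr: "\<alpha> \<notin> \<rat>" and x0: "g x0 \<noteq> 0"
  shows "\<not> (\<lambda>n. g (real n * \<alpha>)) \<longlonglongrightarrow> 0"
proof
  assume lim: "(\<lambda>n. g (real n * \<alpha>)) \<longlonglongrightarrow> 0"
  define c where "c = norm (g x0) / 2"
  have "c > 0" using x0 by (simp add: c_def)
  then obtain N where N: "\<And>n. n \<ge> N \<Longrightarrow> norm (g (real n * \<alpha>)) < c"
    using lim by (auto simp: LIMSEQ_iff)
  obtain d where d: "d > 0" "\<And>x. dist x x0 < d \<Longrightarrow> dist (g x) (g x0) < c"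
    using cont \<open>c > 0\<close> unfolding continuous_on_iff by blast
  \<comment> \<open>Density modulo 1 gives no control on the size of k. Aiming at x0 - N \<alpha>
    instead of x0 makes N + k, which exceeds N, the return time.\<close>
  obtain h k where k: "k > 0" "\<bar>of_int k * \<alpha> - of_int h - (x0 - real N * \<alpha>)\<bar> < d"
    using sequence_of_fractional_parts_is_dense[OF irr d(1)] by metis
  define n where "n = N + nat k"
  have n: "real n * \<alpha> = of_int k * \<alpha> + real N * \<alpha>"
    using k by (simp add: n_def algebra_simps)
  have "real n * \<alpha> + of_int (- h) - x0 = of_int k * \<alpha> - of_int h - (x0 - real N * \<alpha>)"
    unfolding n by simp
  hence "dist (g (real n * \<alpha> + of_int (- h))) (g x0) < c"
    using k(2) by (intro d(2)) (simp only: dist_real_def)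
  hence "dist (g (real n * \<alpha>)) (g x0) < c"
    by (simp only: periodic_of_int[of g, OF per])
  moreover have "norm (g (real n * \<alpha>)) < c"
    by (rule N) (simp add: n_def)
  moreover have "norm (g x0) \<le> norm (g (real n * \<alpha>)) + dist (g (real n * \<alpha>)) (g x0)"
    using norm_triangle_ineq4[of "g (real n * \<alpha>)" "g (real n * \<alpha>) - g x0"] by (simp add: dist_norm)
  ultimately show False by (simp add: c_def)
qed

text \<open>For Re s <= 0 the denominators have modulus at most 1, so the terms dominate the
  coefficients.\<close>

lemma dirichlet_term_summable_imp_coeff_tendsto_0:
  assumes "summable (dirichlet_term a s)" "Re s \<le> 0"
  shows "(\<lambda>k. a (Suc k)) \<longlonglongrightarrow> 0"
proof (rule Lim_null_comparison)
  show "\<forall>\<^sub>F k in sequentially. norm (a (Suc k)) \<le> norm (dirichlet_term a s k)"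
  proof (rule always_eventually, rule allI)
    fix k
    have "norm (of_nat (Suc k) powr s :: complex) = real (Suc k) powr Re s"
      by (subst norm_powr_real_powr) auto
    also have "\<dots> \<le> real (Suc k) powr 0"
      using assms(2) by (intro powr_mono) auto
    finally have "norm (of_nat (Suc k) powr s :: complex) \<le> 1" by simp
    hence "norm (a (Suc k)) / 1 \<le> norm (a (Suc k)) / norm (of_nat (Suc k) powr s :: complex)"
      by (intro divide_left_mono) (auto simp del: of_nat_Suc)
    thus "norm (a (Suc k)) \<le> norm (dirichlet_term a s k)"
      by (simp add: dirichlet_term_def norm_divide)
  qed
  show "(\<lambda>k. norm (dirichlet_term a s k)) \<longlonglongrightarrow> 0"
    using summable_LIMSEQ_zero[OF assms(1)] by (rule tendsto_norm_zero)
qed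

text \<open>The abscissa is claimed only for nonzero \<open>g\<close>: the zero function gives a
  series that converges everywhere, with abscissa minus infinity.\<close>

theorem proposition4:
  fixes g :: "real \<Rightarrow> complex" and \<alpha> :: real
  assumes "\<And>x. g (x + 1) = g x"
    and "real_analytic g"
    and "integral {0..1} g = 0"
    and "diophantine \<alpha>"
  shows "(\<forall>s. Re s > 0 \<longrightarrow> summable (dirichlet_term (zeta_coeff g \<alpha>) s)) \<and>
         zeta g \<alpha> analytic_on {s. Re s > 0} \<and>
         (g \<noteq> (\<lambda>x. 0) \<longrightarrow> has_abscissa_of_convergence (zeta_coeff g \<alpha>) 0)"
proof -
  obtain r where "diophantine_of_type r \<alpha>"
    using assms(4) unfolding diophantine_def by blast
  then obtain M where "\<And>N. norm (\<Sum>k<N. zeta_coeff g \<alpha> (Suc k)) \<le> M"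
    using bounded_birkhoff_sums[OF assms(1-3)] unfolding zeta_coeff_def by blast
  note conv = dirichlet_series_bounded_sums[of "zeta_coeff g \<alpha>", OF this]
  have "zeta g \<alpha> analytic_on {s. Re s > 0}"
    using conv(2) unfolding zeta_def by (simp add: analytic_on_open open_halfspace_Re_gt)
  moreover have "has_abscissa_of_convergence (zeta_coeff g \<alpha>) 0" if "g \<noteq> (\<lambda>x. 0)"
  proof -
    from that obtain x0 where "g x0 \<noteq> 0" by blast
    hence nolim: "\<not> (\<lambda>n. zeta_coeff g \<alpha> n) \<longlonglongrightarrow> 0"
      unfolding zeta_coeff_def
      by (intro orbit_not_tendsto_0 assms(1) real_analytic_continuous_on diophantine_irrational assms(2,4))
    have "\<not> summable (dirichlet_term (zeta_coeff g \<alpha>) s)" if "Re s < 0" for s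
      using dirichlet_term_summable_imp_coeff_tendsto_0[of "zeta_coeff g \<alpha>" s] that nolim
      by (auto simp: filterlim_sequentially_Suc)
    thus ?thesis
      using conv(1) by (simp add: has_abscissa_of_convergence_def)
  qed
  ultimately show ?thesis
    using conv(1) by blast
qed

end
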